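(* Let $0<p<\infty$, $r_h>0$, let $\omega$ be a weight on $\mathbb{D}$ and $\mu=\omega\,dA$. If $\omega\in\mathrm{BHO}(r_h)$ and $\mu$ satisfies the reverse-Carleson tail condition $\mathrm{RC}^\delta$ for some $\delta\in(0,1)$, then the dilations are uniformly bounded on $A^p_\omega$ (UBD): there exists $C>0$ such that $\|T_rf\|\le C\|f\|$ for all $f\in A^p_\omega$ and all $r\in(0,1)$, where $T_rf(z)=f(rz)$.
   Context: $\mathbb{D}$ is the open unit disk in $\mathbb{C}$; $dA=\frac1\pi r\,dr\,d\theta$; a weight $\omega$ is a positive measurable function on $\mathbb{D}$. $A^p_\omega$ is the set of analytic $f$ on $\mathbb{D}$ with $\|f\|=\left(\int_{\mathbb{D}}|f|^p\omega\,dA\right)^{1/p}<\infty$. $\rho_h(z,w)=2\operatorname{artanh}\left|\frac{z-w}{1-\overline{z}w}\right|$ is the hyperbolic distance on $\mathbb{D}$ and $B_{\rho_h}(z,r)$ the hyperbolic ball of center $z$ and radius $r$. Bounded hyperbolic oscillation: $\omega\in\mathrm{BHO}(r_h)$ if there is a constant $\Lambda$ with $\sup_{z\in\mathbb{D}}\sup_{w,w'\in B_{\rho_h}(z,r_h)}\frac{\omega(w)}{\omega(w')}\le\Lambda$. Identify $\partial\mathbb{D}$ with $\mathbb{T}\cong[0,1)$ (so arc length is normalized to total length $1$). For an arc $I\subset\partial\mathbb{D}$ of length $|I|$ and $\delta\in(0,1)$, the Carleson box and its top are $$S(I)=\{z\in\mathbb{D}: z/|z|\in I,\ 1-|I|<|z|<1\},\qquad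 T_\delta(I)=\{z\in\mathbb{D}: z/|z|\in I,\ 1-|I|<|z|<1-\delta|I|\}.$$ The dyadic arcs are $I_{j,m}=[m/2^j,(m+1)/2^j)$, $j\ge0$, $0\le m<2^j$; $\mathcal{D}$ is the collection of all of them. $\mathrm{RC}^\delta$: $\mu$ satisfies $\mathrm{RC}^\delta$ if there exists $\kappa>0$ such that $\mu(S(I))\le(\kappa+1)\mu(T_\delta(I))$ for every $I\in\mathcal{D}$. *)

theory Defs
  imports "HOL-Analysis.Analysis"
begin

abbreviation unit_disk :: "complex set" where
  "unit_disk \<equiv> ball 0 1"

definition disk_area :: "complex measure" where
  "disk_area = scale_measure (ennreal (1 / pi)) (lebesgue_on unit_disk)"

definition weight :: "(complex \<Rightarrow> real) \<Rightarrow> bool" where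
  "weight \<omega> \<longleftrightarrow> \<omega> \<in> borel_measurable (lebesgue_on unit_disk) \<and> (\<forall>z\<in>unit_disk. 0 < \<omega> z)"

definition weighted_area :: "(complex \<Rightarrow> real) \<Rightarrow> complex measure" where
  "weighted_area \<omega> = density disk_area (\<lambda>z. ennreal (\<omega> z))"

text \<open>The norm takes values in \<^typ>\<open>ennreal\<close>, so that an upper bound on it includes its
  finiteness. The first definition is \<open>x\<close> to the power \<open>s\<close> for \<open>s > 0\<close>.\<close>

definition ennreal_powr :: "ennreal \<Rightarrow> real \<Rightarrow> ennreal" where
  "ennreal_powr x s = (if x = \<infinity> then \<infinity> else ennreal (enn2real x powr s))"

definition bergman_norm :: "real \<Rightarrow> (complex \<Rightarrow> real) \<Rightarrow> (complex \<Rightarrow> complex) \<Rightarrow> ennreal" where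
  "bergman_norm p \<omega> f =
     ennreal_powr (\<integral>\<^sup>+ z. ennreal (norm (f z) powr p * \<omega> z) \<partial>disk_area) (1 / p)"

definition bergman_space :: "real \<Rightarrow> (complex \<Rightarrow> real) \<Rightarrow> (complex \<Rightarrow> complex) set" where
  "bergman_space p \<omega> = {f. f holomorphic_on unit_disk \<and> bergman_norm p \<omega> f < \<infinity>}"

definition dilation :: "real \<Rightarrow> (complex \<Rightarrow> complex) \<Rightarrow> complex \<Rightarrow> complex" where
  "dilation r f = (\<lambda>z. f (of_real r * z))"

definition hyp_dist :: "complex \<Rightarrow> complex \<Rightarrow> real" where
  "hyp_dist z w = 2 * artanh (norm ((z - w) / (1 - cnj z * w)))"

definition hyp_ball :: "complex \<Rightarrow> real \<Rightarrow> complex set" where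
  "hyp_ball z r = {w \<in> unit_disk. hyp_dist z w < r}"

definition BHO :: "real \<Rightarrow> (complex \<Rightarrow> real) set" where
  "BHO r = {\<omega>. \<exists>\<Lambda>. \<forall>z\<in>unit_disk. \<forall>w\<in>hyp_ball z r. \<forall>w'\<in>hyp_ball z r. \<omega> w / \<omega> w' \<le> \<Lambda>}"

text \<open>The unit circle is identified with the interval from \<open>0\<close> (included) to \<open>1\<close> (excluded)
  through \<open>t \<mapsto> exp (2 \<pi> i t)\<close>; an arc \<open>I\<close> is a set of such parameters \<open>t\<close>, and its
  normalized length is the Lebesgue measure of \<open>I\<close>. The origin belongs to no box, as \<open>0 / 0 = 0\<close>
  does not lie on the circle.\<close>

definition circle_arc :: "real set \<Rightarrow> complex set" where
  "circle_arc I = (\<lambda>t. cis (2 * pi * t)) ` I"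

definition arc_length :: "real set \<Rightarrow> real" where
  "arc_length I = measure lborel I"

definition carleson_box :: "real set \<Rightarrow> complex set" where
  "carleson_box I = {z \<in> unit_disk. z / of_real (norm z) \<in> circle_arc I \<and>
     1 - arc_length I < norm z \<and> norm z < 1}"

definition carleson_top :: "real \<Rightarrow> real set \<Rightarrow> complex set" where
  "carleson_top \<delta> I = {z \<in> unit_disk. z / of_real (norm z) \<in> circle_arc I \<and>
     1 - arc_length I < norm z \<and> norm z < 1 - \<delta> * arc_length I}"

definition dyadic_arcs :: "real set set" where
  "dyadic_arcs = {{real m / 2 ^ j ..< (real m + 1) / 2 ^ j} | j m :: nat. m < 2 ^ j}"

definition RC :: "real \<Rightarrow> complex measure \<Rightarrow> bool" where
  "RC \<delta> \<mu> \<longleftrightarrow> (\<exists>\<kappa>>0. \<forall>I\<in>dyadic_arcs.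
     emeasure \<mu> (carleson_box I) \<le> ennreal (\<kappa> + 1) * emeasure \<mu> (carleson_top \<delta> I))"

definition uniformly_bounded_dilations :: "real \<Rightarrow> (complex \<Rightarrow> real) \<Rightarrow> bool" where
  "uniformly_bounded_dilations p \<omega> \<longleftrightarrow>
     (\<exists>C>0. \<forall>f\<in>bergman_space p \<omega>. \<forall>r\<in>{0<..<1}.
        bergman_norm p \<omega> (dilation r f) \<le> ennreal C * bergman_norm p \<omega> f)"

end

theory Submission
  imports Defs "HOL-Complex_Analysis.Conformal_Mappings"
begin

text \<open>Since \<open>|f|\<^sup>p\<close> at a point is bounded by its average over a disk of comparable hyperbolic size,
  Tonelli's theorem bounds \<open>\<parallel>T\<^sub>r f\<parallel>\<^sup>p\<close> by the integral of \<open>|f u|\<^sup>p (1 - |u|)\<^sup>-\<^sup>2 \<mu>(E)\<close> over \<open>u\<close>, where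
  \<open>E\<close> consists of the points \<open>z\<close> with \<open>r z\<close> close to \<open>u\<close>. Independently of \<open>r\<close>, this set lies in the tent
  of the points of the disk at distance less than \<open>3 (1 - |u|)\<close> from \<open>u\<close>. The tail condition moves
  the mass of the tent to the tops of boxes near \<open>u\<close>, where bounded oscillation bounds it
  by a multiple of \<open>(1 - |u|)\<^sup>2 \<omega> u\<close>.\<close>

section \<open>Bounded oscillation in Euclidean terms\<close>

text \<open>Since \<open>|1 - cnj z * w| >= 1 - |z|\<close>, the pseudohyperbolic distance of the
  two points is below \<open>tanh (r / 2)\<close>, and \<open>artanh\<close> is increasing. Bounded
  oscillation thus applies to steps that are short relative to the distance from the circle.\<close>

lemma hyp_ball_of_relative_distance:
  assumes "norm z < 1" and "0 < r" and "norm (w - z) < tanh (r / 2) * (1 - norm z)"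
  shows "w \<in> hyp_ball z r"
proof -
  define c where "c = tanh (r / 2)"
  have c: "0 < c" "c < 1"
    using assms(2) tanh_real_lt_1[of "r/2"] by (auto simp: c_def)
  have less: "norm (w - z) < c * (1 - norm z)"
    using assms(3) by (simp add: c_def)
  moreover have "c * (1 - norm z) \<le> 1 - norm z"
    using c assms(1) by (simp add: mult_left_le_one_le)
  ultimately have w: "norm w < 1"
    using norm_triangle_ineq[of z "w - z"] by simp
  define x where "x = norm ((z - w) / (1 - cnj z * w))"
  have "norm z * norm w \<le> norm z"
    using w by (simp add: mult_left_le)
  then have den: "1 - norm z \<le> norm (1 - cnj z * w)"
    using norm_triangle_ineq2[of 1 "cnj z * w"] by (simp add: norm_mult)
  then have "c * (1 - norm z) \<le> c * norm (1 - cnj z * w)"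
    using c by simp
  with less have "norm (z - w) < c * norm (1 - cnj z * w)"
    by (simp add: norm_minus_commute)
  moreover have "0 < norm (1 - cnj z * w)"
    using den assms(1) by linarith
  ultimately have "x < c"
    unfolding x_def norm_divide by (simp only: pos_divide_less_eq)
  moreover have "0 \<le> x"
    by (simp add: x_def)
  \<comment> \<open>By definition \<open>artanh x\<close> is half the logarithm of this quotient, so
    its monotonicity is read off here.\<close>
  ultimately have "(1 + x) / (1 - x) < (1 + c) / (1 - c)"
    using c by (simp add: divide_simps algebra_simps)
  then have "artanh x < artanh c"
    unfolding artanh_def using \<open>0 \<le> x\<close> \<open>x < c\<close> c by simp
  then have "2 * artanh x < r"
    by (simp add: c_def artanh_tanh_real)
  then show ?thesis
    using w by (simp add: hyp_ball_def hyp_dist_def x_def)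
qed

text \<open>By convexity of the norm, a segment stays as far from the circle as its endpoints, so it
  can be followed by a bounded number of steps that are short in the hyperbolic metric.\<close>

lemma BHO_chain:
  assumes "0 < r" and "\<omega> \<in> BHO r" and pos: "\<forall>z\<in>unit_disk. 0 < \<omega> z" and "0 \<le> K"
  obtains M where "0 < M"
    and "\<And>z w. \<lbrakk>norm z < 1; norm w < 1; norm (z - w) \<le> K * min (1 - norm z) (1 - norm w)\<rbrakk>
           \<Longrightarrow> \<omega> z \<le> M * \<omega> w"
proof -
  obtain L0 where L0: "\<And>z w w'. \<lbrakk>z \<in> unit_disk; w \<in> hyp_ball z r; w' \<in> hyp_ball z r\<rbrakk> \<Longrightarrow> \<omega> w / \<omega> w' \<le> L0"
    using assms(2) unfolding BHO_def by blast
  \<comment> \<open>With \<open>1 <= L\<close> the powers of \<open>L\<close> are positive, and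
    multiplying by them preserves inequalities.\<close>
  define L where "L = max 1 L0"
  define c where "c = tanh (r / 2)"
  have c: "0 < c"
    using assms(1) by (simp add: c_def)
  have step: "\<omega> z \<le> L * \<omega> w" if "norm z < 1" "norm (w - z) < c * (1 - norm z)" for z w
  proof -
    have "w \<in> hyp_ball z r" "z \<in> hyp_ball z r"
      using that assms(1) c by (auto intro!: hyp_ball_of_relative_distance simp: c_def)
    moreover from this have "0 < \<omega> w"
      using pos by (auto simp: hyp_ball_def)
    ultimately have "\<omega> z \<le> L0 * \<omega> w"
      using L0[of z z w] that by (simp add: field_simps)
    also have "\<dots> \<le> L * \<omega> w"
      using \<open>0 < \<omega> w\<close> by (simp add: L_def)
    finally show ?thesis .
  qed
  \<comment> \<open>Let \<open>d\<close> be the smaller distance of the endpoints from the circle.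
    Each of \<open>n\<close> equal steps has length at most \<open>K * d / n < c * d\<close>, which
    is admissible all along the segment. This \<open>n\<close> does not depend on the
    endpoints.\<close>
  obtain n :: nat where n: "K / c < real n"
    using reals_Archimedean2 by blast
  moreover have "0 \<le> K / c"
    using c \<open>0 \<le> K\<close> by simp
  ultimately have "0 < n"
    by (simp flip: of_nat_0_less_iff)
  show thesis
  proof (rule that[of "L ^ n"])
    show "0 < L ^ n"
      by (simp add: L_def)
  next
    fix z w :: complex
    assume zw: "norm z < 1" "norm w < 1" "norm (z - w) \<le> K * min (1 - norm z) (1 - norm w)"
    define d where "d = min (1 - norm z) (1 - norm w)"
    have d: "0 < d"
      using zw by (simp add: d_def)
    define y where "y i = z + of_real (real i / real n) * (w - z)" for i :: nat
    have y_norm: "norm (y i) \<le> 1 - d" if "i \<le> n" for i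
    proof -
      define t where "t = real i / real n"
      have t: "0 \<le> t" "t \<le> 1"
        using that \<open>0 < n\<close> by (auto simp: t_def)
      have "y i = of_real (1 - t) * z + of_real t * w"
        unfolding y_def t_def[symmetric] by (simp add: algebra_simps)
      then have "norm (y i) \<le> (1 - t) * norm z + t * norm w"
        using norm_triangle_ineq[of "of_real (1 - t) * z" "of_real t * w"] t
        by (simp add: norm_mult flip: of_real_diff)
      also have "\<dots> \<le> (1 - t) * (1 - d) + t * (1 - d)"
        using t by (intro add_mono mult_left_mono) (auto simp: d_def)
      finally show ?thesis
        by (simp add: algebra_simps)
    qed
    have "\<omega> z \<le> L ^ i * \<omega> (y i)" if "i \<le> n" for i
      using that
    proof (induction i)
      case 0
      show ?case
        by (simp add: y_def)
    next
      case (Suc i)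
      have ni: "norm (y i) \<le> 1 - d"
        using Suc.prems by (intro y_norm) simp
      have "y (Suc i) - y i = of_real (1 / real n) * (w - z)"
        by (simp add: y_def add_divide_distrib distrib_right)
      then have "norm (y (Suc i) - y i) = norm (z - w) / real n"
        by (simp add: norm_divide norm_minus_commute)
      also have "\<dots> \<le> K * d / real n"
        using zw by (intro divide_right_mono) (auto simp: d_def)
      also have "\<dots> < c * d"
        using n c d \<open>0 < n\<close> by (simp add: field_simps)
      also have "\<dots> \<le> c * (1 - norm (y i))"
        using c ni by simp
      finally have "\<omega> (y i) \<le> L * \<omega> (y (Suc i))"
        using ni d by (intro step) auto
      then have "L ^ i * \<omega> (y i) \<le> L ^ i * (L * \<omega> (y (Suc i)))"
        by (intro mult_left_mono) (auto simp: L_def)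
      then show ?case
        using Suc by (simp add: algebra_simps)
    qed
    from this[of n] show "\<omega> z \<le> L ^ n * \<omega> w"
      using \<open>0 < n\<close> by (simp add: y_def)
  qed
qed

section \<open>Pointwise bounds by area averages\<close>

lemma emeasure_ball_complex:
  "0 \<le> r \<Longrightarrow> emeasure lborel (ball (a :: complex) r) = ennreal (pi * r\<^sup>2)"
  using emeasure_ball[of r a] by (simp add: unit_ball_vol_2 power2_eq_square)

text \<open>Near a maximum point \<open>z\<^sub>0\<close> of \<open>(\<rho> - |z - w|)\<^sup>2 |f z|\<^sup>p\<close> the function \<open>|f|\<close> is bounded by a
  multiple of \<open>|f z\<^sub>0|\<close>, hence by the Schwarz lemma comparable to it on a smaller disk. This
  works for all \<open>p > 0\<close> at once and needs no subharmonicity of \<open>|f|\<^sup>p\<close>.\<close>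

lemma powr_norm_le_area_integral:
  assumes p: "0 < (p :: real)"
  obtains A where "0 < A"
    and "\<And>f w R. \<lbrakk>0 < R; f holomorphic_on ball w R\<rbrakk> \<Longrightarrow>
      ennreal (R\<^sup>2 * norm (f w) powr p)
        \<le> ennreal A * (\<integral>\<^sup>+ u. ennreal (norm (f u) powr p) * indicator (ball w R) u \<partial>lebesgue)"
proof -
  \<comment> \<open>\<open>B powr p = 4\<close> matches the factor by which the weight in
    \<open>h\<close> may drop near the maximum point. The choice of \<epsilon> gives
    \<open>(B + 2) * \<epsilon> < 1\<close> with value exactly \<open>1 / 2\<close>, so that
    \<open>f\<close> varies by at most half of \<open>|f z0|\<close> on the smaller disk.\<close>
  define B :: real where "B = 4 powr (1 / p)"
  define \<epsilon> :: real where "\<epsilon> = 1 / (2 * (B + 2))"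
  \<comment> \<open>The factor 16 is 4 from \<open>R = 2 * \<rho>\<close> times 4 from
    \<open>\<rho> - dist w z0 = 2 * d\<close>. The rest undoes the halving of \<open>|f z0|\<close>
    and the area of the smaller disk.\<close>
  define A where "A = 16 * 2 powr p / (pi * \<epsilon>\<^sup>2)"
  have B: "0 < B" and Bp: "B powr p = 4"
    using p by (auto simp: B_def powr_powr)
  have \<epsilon>: "0 < \<epsilon>" "\<epsilon> < 1"
    using B by (auto simp: \<epsilon>_def)
  show thesis
  proof (rule that[of A])
    show "0 < A"
      using \<epsilon> by (simp add: A_def)
  next
    fix f :: "complex \<Rightarrow> complex" and w R
    assume R: "0 < (R :: real)" and f: "f holomorphic_on ball w R"
    define I where "I = (\<integral>\<^sup>+ u. ennreal (norm (f u) powr p) * indicator (ball w R) u \<partial>lebesgue)"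
    define \<rho> where "\<rho> = R / 2"
    \<comment> \<open>The weight vanishes on the boundary of \<open>cball w \<rho>\<close>, so a
      positive maximum of \<open>h\<close> over this compact disk is attained in the
      interior.\<close>
    define h where "h z = (\<rho> - dist w z)\<^sup>2 * norm (f z) powr p" for z
    have \<rho>: "0 < \<rho>" "cball w \<rho> \<subseteq> ball w R"
      using R by (auto simp: \<rho>_def)
    have "continuous_on (cball w \<rho>) f"
      using f \<rho>(2) by (blast intro: holomorphic_on_imp_continuous_on continuous_on_subset)
    then have "continuous_on (cball w \<rho>) h"
      unfolding h_def using p by (intro continuous_intros continuous_on_powr') auto
    then obtain z0 where z0: "z0 \<in> cball w \<rho>" and max: "\<And>z. z \<in> cball w \<rho> \<Longrightarrow> h z \<le> h z0"
      using continuous_attains_sup[of "cball w \<rho>" h] \<rho>(1) by auto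
    have hw: "\<rho>\<^sup>2 * norm (f w) powr p \<le> h z0"
      using max[of w] \<rho>(1) by (simp add: h_def)
    show "ennreal (R\<^sup>2 * norm (f w) powr p) \<le> ennreal A * I"
    proof (cases "f w = 0")
      case True
      then show ?thesis
        by simp
    next
      case False
      then have "0 < h z0"
        using hw \<rho>(1) by (intro less_le_trans[OF _ hw]) simp
      then have z0': "dist w z0 < \<rho>" and fz0: "0 < norm (f z0)"
        using z0 by (auto simp: h_def order_less_le)
      \<comment> \<open>Half the distance from \<open>z0\<close> to the boundary: within
        \<open>d\<close> of \<open>z0\<close> the weight stays above \<open>d^2\<close>, while at
        \<open>z0\<close> it is \<open>(2 * d)^2\<close>. Maximality then bounds
        \<open>|f|^p\<close> there by \<open>4 * |f z0|^p\<close>.\<close>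
      define d where "d = (\<rho> - dist w z0) / 2"
      have d: "0 < d"
        using z0' by (simp add: d_def)
      have far: "d < \<rho> - dist w z" if "dist z0 z < d" for z
        using that dist_triangle[of w z z0] by (simp add: d_def field_simps)
      have sub: "ball z0 d \<subseteq> ball w R"
      proof
        fix z
        assume "z \<in> ball z0 d"
        then show "z \<in> ball w R"
          using far[of z] d R by (simp add: \<rho>_def)
      qed
      have bound: "norm (f z) \<le> B * norm (f z0)" if "dist z0 z < d" for z
      proof (rule ccontr)
        assume "\<not> norm (f z) \<le> B * norm (f z0)"
        then have "(B * norm (f z0)) powr p < norm (f z) powr p"
          using p B by (intro powr_less_mono2) auto
        then have 1: "4 * norm (f z0) powr p < norm (f z) powr p"
          using B by (simp add: powr_mult Bp)
        have "d\<^sup>2 * norm (f z) powr p \<le> h z"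
          unfolding h_def using far[OF that] d by (intro mult_right_mono power_mono) auto
        also have "\<dots> \<le> h z0"
          using far[OF that] d by (intro max) auto
        also have "\<dots> = d\<^sup>2 * (4 * norm (f z0) powr p)"
          by (simp add: h_def d_def power2_eq_square)
        finally show False
          using 1 d by simp
      qed
      \<comment> \<open>The triangle inequality bounds the numerator of \<open>g\<close> by
        \<open>(B + 1) * |f z0|\<close>; one more multiple of \<open>|f z0|\<close> gives the strict
        inequality that the Schwarz lemma requires.\<close>
      define N where "N = (B + 2) * norm (f z0)"
      have N: "0 < N"
        using B fz0 by (simp add: N_def)
      define g where "g \<zeta> = (f (z0 + of_real d * \<zeta>) - f z0) / of_real N" for \<zeta>
      have in_ball: "dist z0 (z0 + of_real d * \<zeta>) < d" if "norm \<zeta> < 1" for \<zeta> :: complex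
        using that d by (simp add: dist_norm norm_mult)
      have "g holomorphic_on ball 0 1"
      proof -
        have "(\<lambda>\<zeta>. z0 + of_real d * \<zeta>) holomorphic_on ball 0 1"
          by (intro holomorphic_intros)
        moreover have "(\<lambda>\<zeta>. z0 + of_real d * \<zeta>) ` ball 0 1 \<subseteq> ball w R"
          using in_ball sub by (auto simp: subset_iff)
        ultimately have "(\<lambda>\<zeta>. f (z0 + of_real d * \<zeta>)) holomorphic_on ball 0 1"
          using holomorphic_on_compose_gen[OF _ f] by (simp add: o_def)
        then show ?thesis
          unfolding g_def using N by (intro holomorphic_intros) auto
      qed
      moreover have "g 0 = 0"
        by (simp add: g_def)
      moreover have "norm (g \<zeta>) < 1" if "norm \<zeta> < 1" for \<zeta>
      proof -
        have "norm (f (z0 + of_real d * \<zeta>) - f z0) \<le> B * norm (f z0) + norm (f z0)"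
          using bound[OF in_ball[OF that]] norm_triangle_ineq4[of "f (z0 + of_real d * \<zeta>)" "f z0"]
          by linarith
        also have "\<dots> < N"
          using fz0 by (simp add: N_def algebra_simps)
        finally show ?thesis
          using N by (simp add: g_def norm_divide)
      qed
      ultimately have schwarz: "norm (g \<zeta>) \<le> norm \<zeta>" if "norm \<zeta> < 1" for \<zeta>
        using Schwarz_Lemma(1)[of g \<zeta>] that by blast
      have lower: "norm (f z0) / 2 \<le> norm (f z)" if "dist z0 z < \<epsilon> * d" for z
      proof -
        define \<zeta> where "\<zeta> = (z - z0) / of_real d"
        have \<zeta>: "norm \<zeta> < \<epsilon>"
          using that d by (simp add: \<zeta>_def norm_divide dist_norm norm_minus_commute field_simps)
        have "norm (f z - f z0) = N * norm (g \<zeta>)"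
          using N d by (simp add: g_def \<zeta>_def norm_divide)
        also have "\<dots> \<le> N * \<epsilon>"
          using schwarz[of \<zeta>] \<zeta> \<epsilon> N by (intro mult_left_mono) auto
        also have "\<dots> = norm (f z0) / 2"
          using B by (simp add: N_def \<epsilon>_def field_simps)
        finally show ?thesis
          using norm_triangle_ineq2[of "f z0" "f z"] by (simp add: norm_minus_commute)
      qed
      have small: "ball z0 (\<epsilon> * d) \<subseteq> ball w R"
        using sub \<epsilon> d by (intro order_trans[OF subset_ball sub]) simp
      have "ennreal ((norm (f z0) / 2) powr p * (pi * (\<epsilon> * d)\<^sup>2))
          = (\<integral>\<^sup>+ u. ennreal ((norm (f z0) / 2) powr p) * indicator (ball z0 (\<epsilon> * d)) u \<partial>lebesgue)"
        using \<epsilon> d by (simp add: nn_integral_cmult_indicator emeasure_ball_complex ennreal_mult)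
      also have "\<dots> \<le> I"
        unfolding I_def using lower p small
        by (intro nn_integral_mono)
          (auto simp: indicator_def subset_iff intro!: ennreal_leI powr_mono2)
      finally have I: "ennreal ((norm (f z0) / 2) powr p * (pi * (\<epsilon> * d)\<^sup>2)) \<le> I" .
      have "R\<^sup>2 * norm (f w) powr p = 4 * (\<rho>\<^sup>2 * norm (f w) powr p)"
        by (simp add: \<rho>_def power2_eq_square)
      also have "\<dots> \<le> 4 * h z0"
        using hw by simp
      also have "\<dots> = A * ((norm (f z0) / 2) powr p * (pi * (\<epsilon> * d)\<^sup>2))"
        using \<epsilon> by (simp add: h_def A_def d_def powr_divide power2_eq_square field_simps)
      finally have "ennreal (R\<^sup>2 * norm (f w) powr p)
          \<le> ennreal A * ennreal ((norm (f z0) / 2) powr p * (pi * (\<epsilon> * d)\<^sup>2))"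
        using \<open>0 < \<epsilon>\<close> by (simp add: A_def ennreal_leI flip: ennreal_mult)
      also have "\<dots> \<le> ennreal A * I"
        by (intro mult_left_mono I) simp
      finally show ?thesis .
    qed
  qed
qed

section \<open>Dyadic arcs and Carleson boxes\<close>

text \<open>Continuous images of Borel sets need not be Borel, but those of compact sets are
  compact, and a half-open interval is a countable union of compact ones.\<close>

lemma circle_arc_borel: "circle_arc {a..<b} \<in> sets borel"
proof -
  have "{a..<b} = (\<Union>n. {a..b - 1 / real (Suc n)})"
  proof safe
    fix x
    assume "x \<in> {a..<b}"
    then have "0 < b - x" "a \<le> x"
      by auto
    then obtain n where "1 / real (Suc n) < b - x"
      using nat_approx_posE by blast
    then show "x \<in> (\<Union>n. {a..b - 1 / real (Suc n)})"
      using \<open>a \<le> x\<close> by (auto intro!: exI[of _ n])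
  next
    fix x n
    assume "x \<in> {a..b - 1 / real (Suc n)}"
    moreover have "0 < 1 / real (Suc n)"
      by simp
    ultimately show "x \<in> {a..<b}"
      unfolding atLeastAtMost_iff atLeastLessThan_iff by linarith
  qed
  then have "circle_arc {a..<b} = (\<Union>n. (\<lambda>t. cis (2 * pi * t)) ` {a..b - 1 / real (Suc n)})"
    by (simp add: circle_arc_def image_UN)
  moreover have "(\<lambda>t. cis (2 * pi * t)) ` {a..b - 1 / real (Suc n)} \<in> sets borel" for n
    by (intro borel_compact compact_continuous_image continuous_intros) auto
  ultimately show ?thesis
    by auto
qed

lemma carleson_borel:
  shows "carleson_box {a..<b} \<in> sets borel" and "carleson_top \<delta> {a..<b} \<in> sets borel"
proof -
  have [measurable]: "circle_arc {a..<b} \<in> sets borel"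
    by (rule circle_arc_borel)
  have [measurable]: "(\<lambda>z :: complex. z / of_real (norm z)) \<in> borel_measurable borel"
    by measurable
  have *: "{z :: complex. z / of_real (norm z) \<in> circle_arc {a..<b}} \<in> sets borel"
    by measurable
  have "carleson_box {a..<b} = unit_disk \<inter> {z. z / of_real (norm z) \<in> circle_arc {a..<b}}
      \<inter> {z. 1 - arc_length {a..<b} < norm z} \<inter> {z. norm z < 1}"
    by (auto simp: carleson_box_def)
  also have "\<dots> \<in> sets borel"
    by (intro sets.Int * borel_open[OF open_ball] borel_open[OF open_Collect_less] continuous_intros)
  finally show "carleson_box {a..<b} \<in> sets borel" .
  have "carleson_top \<delta> {a..<b} = unit_disk \<inter> {z. z / of_real (norm z) \<in> circle_arc {a..<b}}
      \<inter> {z. 1 - arc_length {a..<b} < norm z} \<inter> {z. norm z < 1 - \<delta> * arc_length {a..<b}}"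
    by (auto simp: carleson_top_def)
  also have "\<dots> \<in> sets borel"
    by (intro sets.Int * borel_open[OF open_ball] borel_open[OF open_Collect_less] continuous_intros)
  finally show "carleson_top \<delta> {a..<b} \<in> sets borel" .
qed

text \<open>The chord has length \<open>2 * |sin ((a - b) / 2)|\<close>.\<close>

lemma dist_cis_le: "dist (cis a) (cis b) \<le> \<bar>a - b\<bar>"
proof -
  have "cis a - cis b = cis b * (exp (\<i> * of_real (a - b)) - 1)"
    by (simp add: cis_conv_exp algebra_simps flip: exp_add)
  then have "dist (cis a) (cis b) = 2 * \<bar>sin ((a - b) / 2)\<bar>"
    by (simp only: dist_norm norm_mult dist_exp_i_1 norm_cis mult_1)
  also have "\<dots> \<le> \<bar>a - b\<bar>"
    using abs_sin_x_le_abs_x[of "(a - b) / 2"] by simp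
  finally show ?thesis .
qed

text \<open>Indexing by generation and position allows sums and disjointness statements over the
  arcs of one generation.\<close>

definition dyadic_arc :: "nat \<Rightarrow> nat \<Rightarrow> real set" where
  "dyadic_arc j m = {real m / 2 ^ j ..< (real m + 1) / 2 ^ j}"

lemma dyadic_arc_in_dyadic_arcs: "m < 2 ^ j \<Longrightarrow> dyadic_arc j m \<in> dyadic_arcs"
  by (auto simp: dyadic_arcs_def dyadic_arc_def)

lemma arc_length_dyadic_arc: "arc_length (dyadic_arc j m) = 1 / 2 ^ j"
  by (simp add: arc_length_def dyadic_arc_def field_simps)

lemma dyadic_arc_subset:
  assumes "m < 2 ^ j"
  shows "dyadic_arc j m \<subseteq> {0..<1}"
proof -
  have "real (m + 1) \<le> real (2 ^ j)"
    using assms by (simp only: of_nat_le_iff)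
  then have "(real m + 1) / 2 ^ j \<le> 1"
    by (simp add: field_simps)
  moreover have "0 \<le> real m / 2 ^ j"
    by simp
  ultimately show ?thesis
    unfolding dyadic_arc_def by (auto simp del: zero_le_divide_iff)
qed

lemma dyadic_arc_index: "t \<in> dyadic_arc j m \<Longrightarrow> m = nat \<lfloor>t * 2 ^ j\<rfloor>"
  using floor_unique[of "int m" "t * 2 ^ j"] by (simp add: dyadic_arc_def field_simps)

text \<open>The two exponents differ by less than the period of the exponential function.\<close>

lemma cis_2pi_inj:
  assumes "s \<in> {0..<1}" "t \<in> {0..<1}" "cis (2 * pi * s) = cis (2 * pi * t)"
  shows "s = t"
proof -
  have "\<bar>s - t\<bar> < 1"
    using assms by auto
  then have "\<bar>2 * pi * s - 2 * pi * t\<bar> < 2 * pi"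
    by (simp add: abs_mult flip: right_diff_distrib)
  then have "\<bar>Im (\<i> * of_real (2 * pi * s)) - Im (\<i> * of_real (2 * pi * t))\<bar> < 2 * pi"
    by simp
  then have "\<i> * of_real (2 * pi * s) = \<i> * of_real (2 * pi * t)"
    by (rule exp_complex_eqI) (use assms(3) in \<open>simp only: cis_conv_exp\<close>)
  then show ?thesis
    by simp
qed

text \<open>A common point would have a single parameter lying in both arcs, and this parameter
  determines the position \<open>m\<close> as an integer part.\<close>

lemma carleson_top_disjoint:
  "disjoint_family_on (\<lambda>m. carleson_top \<delta> (dyadic_arc j m)) {..<2 ^ j}"
  unfolding disjoint_family_on_def
proof (intro ballI impI, rule ccontr)
  fix m n
  assume mn: "m \<in> {..<(2 :: nat) ^ j}" "n \<in> {..<(2 :: nat) ^ j}" "m \<noteq> n"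
    and "carleson_top \<delta> (dyadic_arc j m) \<inter> carleson_top \<delta> (dyadic_arc j n) \<noteq> {}"
  then obtain s t where st: "s \<in> dyadic_arc j m" "t \<in> dyadic_arc j n" "cis (2 * pi * s) = cis (2 * pi * t)"
    by (fastforce simp: carleson_top_def circle_arc_def)
  then have "s = t"
    using mn dyadic_arc_subset by (intro cis_2pi_inj) blast+
  with st mn show False
    using dyadic_arc_index by metis
qed

lemma carleson_top_subset: "0 < \<delta> \<Longrightarrow> carleson_top \<delta> I \<subseteq> carleson_box I"
  by (auto simp: carleson_top_def carleson_box_def)

text \<open>A radial move followed by a move along a circle leads from \<open>z\<close> to
  \<open>w\<close>. With \<open>l = 1 / 2 ^ j\<close> the first costs at most \<open>l\<close> and
  the second at most \<open>2 * pi * l\<close>, and \<open>1 + 2 * pi <= 8\<close>.\<close>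

lemma carleson_box_dist:
  assumes "z \<in> carleson_box (dyadic_arc j m)" "w \<in> carleson_box (dyadic_arc j m)"
  shows "dist z w \<le> 8 / 2 ^ j"
proof -
  have polar: "\<exists>t\<in>dyadic_arc j m. x = of_real (norm x) * cis (2 * pi * t)
      \<and> 1 - 1 / 2 ^ j < norm x \<and> norm x < 1" if x: "x \<in> carleson_box (dyadic_arc j m)" for x
  proof -
    obtain t where t: "t \<in> dyadic_arc j m" "x / of_real (norm x) = cis (2 * pi * t)"
      using x by (auto simp: carleson_box_def circle_arc_def)
    \<comment> \<open>At the origin the quotient is \<open>0\<close>, whereas \<open>cis\<close> has
      norm one.\<close>
    then have "x \<noteq> 0"
      by auto
    with t x show ?thesis
      by (intro bexI[of _ t]) (auto simp: carleson_box_def arc_length_dyadic_arc field_simps)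
  qed
  obtain s t where st: "s \<in> dyadic_arc j m" "t \<in> dyadic_arc j m"
    and z: "z = of_real (norm z) * cis (2 * pi * s)" "1 - 1 / 2 ^ j < norm z" "norm z < 1"
    and w: "w = of_real (norm w) * cis (2 * pi * t)" "1 - 1 / 2 ^ j < norm w" "norm w < 1"
    using polar[OF assms(1)] polar[OF assms(2)] by blast
  have "z - w = of_real (norm z - norm w) * cis (2 * pi * s)
      + of_real (norm w) * (cis (2 * pi * s) - cis (2 * pi * t))"
    by (subst z(1), subst w(1)) (simp add: algebra_simps)
  then have "dist z w \<le> \<bar>norm z - norm w\<bar> + norm w * dist (cis (2 * pi * s)) (cis (2 * pi * t))"
    using norm_triangle_ineq[of "of_real (norm z - norm w) * cis (2 * pi * s)"
        "of_real (norm w) * (cis (2 * pi * s) - cis (2 * pi * t))"]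
    by (simp add: dist_norm norm_mult flip: of_real_diff)
  also have "\<dots> \<le> 1 / 2 ^ j + 1 * \<bar>2 * pi * s - 2 * pi * t\<bar>"
    using z w by (intro add_mono mult_mono dist_cis_le) (auto simp: abs_le_iff)
  also have "\<bar>2 * pi * s - 2 * pi * t\<bar> = 2 * pi * \<bar>s - t\<bar>"
    by (simp add: abs_mult flip: right_diff_distrib)
  also have "\<bar>s - t\<bar> \<le> 1 / 2 ^ j"
    using st by (auto simp: dyadic_arc_def add_divide_distrib)
  also have "1 / 2 ^ j + 1 * (2 * pi * (1 / 2 ^ j)) \<le> 8 / (2 :: real) ^ j"
    using pi_approx by (simp add: field_simps)
  finally show ?thesis
    by simp
qed

text \<open>The argument divided by \<open>2 * pi\<close> is the parameter \<open>t\<close>, and the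
  integer part of \<open>t * 2 ^ j\<close> is the position of the arc. The origin has no direction
  and lies in no box.\<close>

lemma in_carleson_box:
  assumes "norm z < 1" "z \<noteq> 0" "1 - norm z < 1 / 2 ^ j"
  shows "\<exists>m<2 ^ j. z \<in> carleson_box (dyadic_arc j m)"
proof -
  define t where "t = Arg2pi z / (2 * pi)"
  define m where "m = nat \<lfloor>t * 2 ^ j\<rfloor>"
  have t: "0 \<le> t" "t < 1"
    using Arg2pi_ge_0[of z] Arg2pi_lt_2pi[of z] by (auto simp: t_def)
  have "z / of_real (norm z) = cis (2 * pi * t)"
    using Arg2pi_eq[of z] assms(2) by (simp add: t_def cis_conv_exp field_simps)
  moreover have m: "real m \<le> t * 2 ^ j" "t * 2 ^ j < real m + 1"
    using t by (auto simp: m_def of_nat_nat)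
  then have "t \<in> dyadic_arc j m"
    by (simp add: dyadic_arc_def field_simps)
  moreover have "t * 2 ^ j < 1 * 2 ^ j"
    using t by (intro mult_strict_right_mono) auto
  then have "real m < 2 ^ j"
    using m(1) by linarith
  then have "m < 2 ^ j"
    by simp
  ultimately show ?thesis
    using assms by (intro exI[of _ m]) (auto simp: carleson_box_def circle_arc_def arc_length_dyadic_arc)
qed

text \<open>The least \<open>j\<close> satisfying the upper bound works: if \<open>j\<close> is
  positive, failure at \<open>j - 1\<close> gives \<open>4 * d < 1 / 2 ^ j\<close>. The minimum with
  1 accounts for \<open>j = 0\<close>, where no coarser generation exists.\<close>

lemma dyadic_scale:
  fixes d :: real
  assumes "0 < d"
  obtains j :: nat where "min 1 (4 * d) \<le> 1 / 2 ^ j" "1 / 2 ^ j \<le> 8 * d"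
proof -
  have "\<exists>j. 1 / 2 ^ j \<le> 8 * d"
    using real_arch_pow_inv[of "8 * d" "1 / 2"] assms
    by (auto simp: power_one_over dest: less_imp_le)
  then have j: "1 / 2 ^ (LEAST j. 1 / 2 ^ j \<le> 8 * d) \<le> 8 * d"
    by (rule LeastI_ex)
  show thesis
  proof (cases "LEAST j. 1 / 2 ^ j \<le> 8 * d")
    case 0
    then show thesis
      using that[of 0] j by simp
  next
    case (Suc i)
    then have "\<not> 1 / 2 ^ i \<le> 8 * d"
      using not_less_Least[of i "\<lambda>j. 1 / 2 ^ j \<le> 8 * d"] by simp
    then show thesis
      using that[of "Suc i"] j Suc by simp
  qed
qed

section \<open>Weighted area and the mass of tents\<close>

lemma space_disk_area [simp]: "space disk_area = unit_disk"
  by (simp add: disk_area_def space_scale_measure)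

lemma sets_disk_area [measurable_cong]: "sets disk_area = sets (lebesgue_on unit_disk)"
  by (simp add: disk_area_def)

lemma measurable_disk_area_iff:
  "g \<in> measurable disk_area M \<longleftrightarrow> g \<in> measurable (lebesgue_on unit_disk) M"
  by (rule arg_cong[where f = "\<lambda>A. g \<in> A"], rule measurable_cong_sets) (auto simp: sets_disk_area)

lemma borel_sets_disk_area: "\<lbrakk>X \<in> sets borel; X \<subseteq> unit_disk\<rbrakk> \<Longrightarrow> X \<in> sets disk_area"
  by (auto simp: sets_disk_area sets_restrict_space_iff)

lemma emeasure_disk_area:
  assumes "X \<in> sets borel" "X \<subseteq> unit_disk"
  shows "emeasure disk_area X = ennreal (1 / pi) * emeasure lborel X"
proof -
  have "X \<in> sets lebesgue"
    using assms(1) by simp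
  then show ?thesis
    using assms by (simp add: disk_area_def emeasure_restrict_space)
qed

lemma emeasure_weighted_area_le:
  assumes "weight \<omega>" and "X \<in> sets borel" "X \<subseteq> unit_disk" and "\<And>z. z \<in> X \<Longrightarrow> \<omega> z \<le> s"
  shows "emeasure (weighted_area \<omega>) X \<le> ennreal s * emeasure disk_area X"
proof -
  have X: "X \<in> sets disk_area"
    using assms by (intro borel_sets_disk_area)
  have [measurable]: "\<omega> \<in> borel_measurable disk_area"
    using assms(1) by (simp add: weight_def measurable_disk_area_iff)
  have "emeasure (weighted_area \<omega>) X = (\<integral>\<^sup>+ z. ennreal (\<omega> z) * indicator X z \<partial>disk_area)"
    unfolding weighted_area_def using X by (intro emeasure_density) auto
  also have "\<dots> \<le> (\<integral>\<^sup>+ z. ennreal s * indicator X z \<partial>disk_area)"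
    using assms(4) by (intro nn_integral_mono) (auto simp: indicator_def intro: ennreal_leI)
  also have "\<dots> = ennreal s * emeasure disk_area X"
    using X by (rule nn_integral_cmult_indicator)
  finally show ?thesis .
qed

lemma sets_weighted_area: "sets (weighted_area \<omega>) = sets disk_area"
  by (simp add: weighted_area_def)

text \<open>Only boxes at the scale of \<open>1 - |u|\<close> are needed. Their tops lie at bounded hyperbolic distance
  from \<open>u\<close> and are disjoint, so their areas add up to at most a multiple of \<open>(1 - |u|)\<^sup>2\<close>.\<close>

lemma weighted_area_tent_le:
  assumes r: "0 < r" and \<omega>: "weight \<omega>" "\<omega> \<in> BHO r"
    and \<delta>: "0 < \<delta>" "\<delta> < 1" "RC \<delta> (weighted_area \<omega>)"
  obtains C where "0 < C"
    and "\<And>u. norm u < 1 \<Longrightarrow> emeasure (weighted_area \<omega>) (unit_disk \<inter> ball u (3 * (1 - norm u)))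
           \<le> ennreal (C * (1 - norm u)\<^sup>2 * \<omega> u)"
proof -
  define \<mu> where "\<mu> = weighted_area \<omega>"
  obtain \<kappa> where \<kappa>: "0 < \<kappa>"
    and RC: "\<And>I. I \<in> dyadic_arcs \<Longrightarrow>
      emeasure \<mu> (carleson_box I) \<le> ennreal (\<kappa> + 1) * emeasure \<mu> (carleson_top \<delta> I)"
    using \<delta>(3) unfolding RC_def \<mu>_def by blast
  have pos: "\<forall>z\<in>unit_disk. 0 < \<omega> z"
    using \<omega>(1) by (simp add: weight_def)
  \<comment> \<open>A point in one of the tops used below is within \<open>67 * d\<close> of
    \<open>u\<close>, where \<open>d = 1 - |u|\<close>, and both points are at least
    \<open>\<delta> * d\<close> away from the circle.\<close>
  obtain M where M: "0 < M"
    and chain: "\<And>z w. \<lbrakk>norm z < 1; norm w < 1; norm (z - w) \<le> 67 / \<delta> * min (1 - norm z) (1 - norm w)\<rbrakk>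
           \<Longrightarrow> \<omega> z \<le> M * \<omega> w"
    using BHO_chain[OF r \<omega>(2) pos, of "67 / \<delta>"] \<delta> by auto
  \<comment> \<open>The factors come from the tail condition, from the oscillation between the tops
    and \<open>u\<close>, and from the normalized area of a disk of radius
    \<open>68 * d\<close>.\<close>
  define C where "C = (\<kappa> + 1) * M * 68\<^sup>2"
  show thesis
  proof (rule that[of C])
    show "0 < C"
      using \<kappa> M by (simp add: C_def)
  next
    fix u :: complex
    assume u: "norm u < 1"
    define d where "d = 1 - norm u"
    have d: "0 < d" "d \<le> 1"
      using u by (auto simp: d_def)
    \<comment> \<open>The lower bound makes the boxes tall enough to cover the tent; the upper bound
      keeps their diameter at most \<open>64 * d\<close>.\<close>
    obtain j where j: "min 1 (4 * d) \<le> 1 / 2 ^ j" "1 / 2 ^ j \<le> 8 * d"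
      using dyadic_scale[OF d(1)] .
    define S where "S m = carleson_box (dyadic_arc j m)" for m
    define T where "T m = carleson_top \<delta> (dyadic_arc j m)" for m
    define U where "U = unit_disk \<inter> ball u (3 * d)"
    define J where "J = {m. m < 2 ^ j \<and> S m \<inter> U \<noteq> {}}"
    have J: "finite J" "J \<subseteq> {..<2 ^ j}"
      by (auto simp: J_def)
    have ST: "S m \<in> sets borel" "T m \<in> sets borel" "T m \<subseteq> S m" "S m \<subseteq> unit_disk" for m
      using carleson_borel carleson_top_subset[OF \<delta>(1)]
      by (auto simp: S_def T_def dyadic_arc_def carleson_box_def)
    then have ST_sets: "S m \<in> sets \<mu>" "T m \<in> sets \<mu>" for m
      using borel_sets_disk_area[OF ST(1,4)] borel_sets_disk_area[OF ST(2) order_trans[OF ST(3,4)]]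
      by (simp_all add: \<mu>_def sets_weighted_area)
    have "{0 :: complex} \<in> sets \<mu>"
      by (auto simp: \<mu>_def sets_weighted_area intro!: borel_sets_disk_area)
    have near: "dist u z < 68 * d" if m: "m \<in> J" and z: "z \<in> S m" for m z
    proof -
      obtain x where x: "x \<in> S m" "dist u x < 3 * d"
        using m by (auto simp: J_def U_def)
      have "dist u z \<le> dist u x + dist x z"
        by (rule dist_triangle)
      also have "\<dots> < 3 * d + 8 / 2 ^ j"
        using x z by (intro add_less_le_mono carleson_box_dist) (auto simp: S_def)
      also have "\<dots> \<le> 68 * d"
        using j(2) d by simp
      finally show ?thesis .
    qed
    have comparable: "\<omega> z \<le> M * \<omega> u" if m: "m \<in> J" and z: "z \<in> T m" for m z
    proof (rule chain)
      show "norm z < 1" "norm u < 1"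
        using z u by (auto simp: T_def carleson_top_def)
      obtain x where x: "x \<in> S m" "dist u x < 3 * d"
        using m by (auto simp: J_def U_def)
      have "dist z u \<le> dist u x + dist x z"
        using dist_triangle[of u z x] by (simp add: dist_commute)
      also have "\<dots> \<le> 3 * d + 8 / 2 ^ j"
        using x z ST(3) by (intro add_mono carleson_box_dist) (auto simp: S_def)
      also have "\<dots> \<le> 67 * d"
        using j(2) by simp
      finally have zu: "norm (z - u) \<le> 67 * d"
        by (simp add: dist_norm)
      \<comment> \<open>Here the truncation of the top enters: it keeps \<open>z\<close> at distance
        more than \<delta> times the arc length from the circle.\<close>
      have "\<delta> * d \<le> \<delta> * (1 / 2 ^ j)"
        using \<delta> d j(1) by (intro mult_left_mono) auto
      also have "\<dots> < 1 - norm z"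
        using z by (simp add: T_def carleson_top_def arc_length_dyadic_arc)
      finally have "\<delta> * d \<le> min (1 - norm z) (1 - norm u)"
        using d \<delta> by (simp add: d_def mult_left_le_one_le)
      then have "67 / \<delta> * (\<delta> * d) \<le> 67 / \<delta> * min (1 - norm z) (1 - norm u)"
        using \<delta> by (intro mult_left_mono) auto
      then show "norm (z - u) \<le> 67 / \<delta> * min (1 - norm z) (1 - norm u)"
        using zu \<delta> by simp
    qed
    \<comment> \<open>Points of the tent satisfy \<open>1 - |z| < 4 * d\<close>, and
      \<open>1 - |z| < 1\<close> away from the origin, so a box of generation \<open>j\<close>
      contains them. The origin is added separately, as a null set.\<close>
    have cover: "U \<subseteq> {0} \<union> (\<Union>m\<in>J. S m)"
    proof
      fix z
      assume z: "z \<in> U"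
      show "z \<in> {0} \<union> (\<Union>m\<in>J. S m)"
      proof (cases "z = 0")
        case False
        then have "0 < norm z"
          by simp
        moreover have "norm u - norm z < 3 * d"
          using z norm_triangle_ineq2[of u z] by (simp add: U_def dist_norm)
        ultimately have "1 - norm z < min 1 (4 * d)"
          unfolding min_less_iff_conj using d_def by linarith
        then have "1 - norm z < 1 / 2 ^ j"
          using j(1) by linarith
        then show ?thesis
          using in_carleson_box[of z j] z False by (fastforce simp: U_def J_def S_def)
      qed simp
    qed
    have zero: "emeasure \<mu> {0} = 0"
      using emeasure_weighted_area_le[OF \<omega>(1), of "{0}" "\<omega> 0"]
      by (simp add: \<mu>_def emeasure_disk_area)
    have "emeasure \<mu> U \<le> emeasure \<mu> ({0} \<union> (\<Union>m\<in>J. S m))"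
      using cover ST_sets J(1) \<open>{0} \<in> sets \<mu>\<close> by (intro emeasure_mono sets.Un sets.finite_UN)
    also have "\<dots> \<le> emeasure \<mu> {0} + emeasure \<mu> (\<Union>m\<in>J. S m)"
      using ST_sets J(1) \<open>{0} \<in> sets \<mu>\<close> by (intro emeasure_subadditive sets.finite_UN)
    also have "\<dots> \<le> (\<Sum>m\<in>J. emeasure \<mu> (S m))"
      unfolding zero using ST_sets J(1) by (auto intro: emeasure_subadditive_finite)
    also have "\<dots> \<le> (\<Sum>m\<in>J. ennreal (\<kappa> + 1) * emeasure \<mu> (T m))"
      unfolding S_def T_def using J(2)
      by (intro sum_mono RC dyadic_arc_in_dyadic_arcs) auto
    also have "\<dots> = ennreal (\<kappa> + 1) * emeasure \<mu> (\<Union>m\<in>J. T m)"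
    proof -
      \<comment> \<open>By disjointness the sum is the mass of the union, so the number of boxes
        does not enter the constant.\<close>
      have "disjoint_family_on T J"
        unfolding T_def using carleson_top_disjoint J(2) by (rule disjoint_family_on_mono[rotated])
      then have "(\<Sum>m\<in>J. emeasure \<mu> (T m)) = emeasure \<mu> (\<Union>m\<in>J. T m)"
        using ST_sets J(1) by (intro sum_emeasure) auto
      then show ?thesis
        by (simp flip: sum_distrib_left)
    qed
    also have "\<dots> \<le> ennreal (\<kappa> + 1) * (ennreal (M * \<omega> u) * ennreal (68\<^sup>2 * d\<^sup>2))"
    proof (rule mult_left_mono)
      have UT: "(\<Union>m\<in>J. T m) \<in> sets borel" "(\<Union>m\<in>J. T m) \<subseteq> unit_disk"
        using ST J(1) by blast+
      have "emeasure \<mu> (\<Union>m\<in>J. T m) \<le> ennreal (M * \<omega> u) * emeasure disk_area (\<Union>m\<in>J. T m)"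
        unfolding \<mu>_def using UT comparable by (intro emeasure_weighted_area_le \<omega>(1)) auto
      also have "emeasure disk_area (\<Union>m\<in>J. T m) = ennreal (1 / pi) * emeasure lborel (\<Union>m\<in>J. T m)"
        using UT by (rule emeasure_disk_area)
      also have "emeasure lborel (\<Union>m\<in>J. T m) \<le> emeasure lborel (ball u (68 * d))"
        using near ST(3) by (intro emeasure_mono) (auto simp: subset_iff)
      also have "\<dots> = ennreal (pi * (68 * d)\<^sup>2)"
        using d by (intro emeasure_ball_complex) simp
      also have "ennreal (1 / pi) * \<dots> = ennreal (68\<^sup>2 * d\<^sup>2)"
        by (simp add: power_mult_distrib flip: ennreal_mult)
      finally show "emeasure \<mu> (\<Union>m\<in>J. T m) \<le> ennreal (M * \<omega> u) * ennreal (68\<^sup>2 * d\<^sup>2)"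
        by (simp add: mult_left_mono)
    qed simp
    also have "\<dots> = ennreal (C * d\<^sup>2 * \<omega> u)"
      using \<kappa> M pos u
      by (simp add: C_def mult_ac less_imp_le del: ennreal_plus distrib_left_numeral distrib_right_numeral
          flip: ennreal_mult)
    finally show "emeasure (weighted_area \<omega>) (unit_disk \<inter> ball u (3 * (1 - norm u)))
        \<le> ennreal (C * (1 - norm u)\<^sup>2 * \<omega> u)"
      by (simp add: \<mu>_def U_def d_def)
  qed
qed

section \<open>The kernel bound for dilations\<close>

text \<open>With \<open>s = 1 / p\<close> this passes from integrals to norms. If \<open>y\<close>
  is infinite, so is the right side because \<open>c powr s\<close> is positive; otherwise both
  quantities are finite and real powers are monotone.\<close>

lemma ennreal_powr_le_mult:
  assumes "x \<le> ennreal c * y" "0 < c" "0 < s"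
  shows "ennreal_powr x s \<le> ennreal (c powr s) * ennreal_powr y s"
proof (cases "y = \<infinity>")
  case True
  then show ?thesis
    using assms(2) by (simp add: ennreal_powr_def ennreal_mult_top)
next
  case False
  then obtain b where b: "0 \<le> b" "y = ennreal b"
    by (cases y) auto
  with assms have x: "x \<le> ennreal (c * b)"
    by (simp add: ennreal_mult)
  then obtain a where a: "0 \<le> a" "x = ennreal a"
    by (cases x) (auto simp: top_unique)
  then have "a powr s \<le> (c * b) powr s"
    using x b assms by (intro powr_mono2) auto
  then show ?thesis
    using a b assms by (simp add: ennreal_powr_def powr_mult ennreal_leI flip: ennreal_mult)
qed

text \<open>Needed for Tonelli's theorem; the disk has finite area.\<close>

lemma sigma_finite_disk_area: "sigma_finite_measure disk_area"
proof -
  have "emeasure disk_area unit_disk \<noteq> \<infinity>"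
    by (simp add: emeasure_disk_area emeasure_ball_complex ennreal_mult_eq_top_iff)
  then have "finite_measure disk_area"
    by (intro finite_measureI) simp
  then show ?thesis
    by (rule finite_measure.axioms)
qed

lemma holomorphic_measurable_disk_area:
  "f holomorphic_on unit_disk \<Longrightarrow> f \<in> borel_measurable disk_area"
  unfolding measurable_disk_area_iff
  by (intro continuous_imp_measurable_on_sets_lebesgue holomorphic_on_imp_continuous_on) auto

text \<open>The area averages are taken in the plane with unnormalized Lebesgue measure; this is the
  conversion.\<close>

lemma nn_integral_disk_area:
  assumes "g \<in> borel_measurable disk_area"
  shows "(\<integral>\<^sup>+ u. g u * indicator unit_disk u \<partial>lebesgue) = ennreal pi * (\<integral>\<^sup>+ u. g u \<partial>disk_area)"
proof -
  have "(\<integral>\<^sup>+ u. g u \<partial>disk_area) = ennreal (1 / pi) * (\<integral>\<^sup>+ u. g u * indicator unit_disk u \<partial>lebesgue)"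
    using assms unfolding disk_area_def measurable_disk_area_iff[unfolded disk_area_def]
    by (simp add: nn_integral_scale_measure nn_integral_restrict_space)
  then have "ennreal pi * (\<integral>\<^sup>+ u. g u \<partial>disk_area)
      = ennreal (pi * (1 / pi)) * (\<integral>\<^sup>+ u. g u * indicator unit_disk u \<partial>lebesgue)"
    by (simp only: ennreal_mult mult.assoc pi_ge_zero divide_nonneg_nonneg zero_le_one)
  then show ?thesis
    by simp
qed

text \<open>The point \<open>r z\<close> may be much deeper in the disk than \<open>z\<close>, but then \<open>1 - r \<le> 1 - |r z|\<close> keeps
  \<open>z\<close> in the tent over every \<open>u\<close> near \<open>r z\<close>. The resulting kernel is independent of \<open>r\<close>.\<close>

lemma dilation_near:
  fixes r :: real and u z :: complex
  assumes "0 < r" "r < 1" "norm z < 1" and w: "w = of_real r * z"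
    and u: "dist w u < (1 - norm w) / 2"
  shows "dist u z < 3 * (1 - norm u)" and "1 - norm u \<le> 3 * ((1 - norm w) / 2)" and "norm u < 1"
proof -
  have wr: "norm w \<le> r"
    using assms by (simp add: norm_mult mult_left_le)
  have 1: "norm u - norm w \<le> dist w u" "norm w - norm u \<le> dist w u"
    using norm_triangle_ineq2[of u w] norm_triangle_ineq2[of w u]
    by (simp_all add: dist_norm norm_minus_commute)
  show "1 - norm u \<le> 3 * ((1 - norm w) / 2)" "norm u < 1"
    using 1 u wr \<open>r < 1\<close> by auto
  have "z - w = of_real (1 - r) * z"
    by (simp add: w algebra_simps)
  then have "dist w z = (1 - r) * norm z"
    using \<open>r < 1\<close> by (simp add: dist_norm norm_mult norm_minus_commute[of w] flip: of_real_diff)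
  also have "\<dots> \<le> 1 - r"
    using assms by (simp add: mult_left_le)
  finally show "dist u z < 3 * (1 - norm u)"
    using dist_triangle[of u z w] 1 u wr by (simp add: dist_commute)
qed

theorem theorem1p16:
  fixes p r\<^sub>h :: real and \<omega> :: "complex \<Rightarrow> real" and \<mu> :: "complex measure"
  assumes "0 < p" and "0 < r\<^sub>h"
    and "weight \<omega>"
    and "\<mu> = weighted_area \<omega>"
    and "\<omega> \<in> BHO r\<^sub>h"
    and "\<exists>\<delta>\<in>{0<..<1}. RC \<delta> \<mu>"
  shows "uniformly_bounded_dilations p \<omega>"
proof -
  obtain C where C: "0 < C"
    and tent: "\<And>u. norm u < 1 \<Longrightarrow> emeasure \<mu> (unit_disk \<inter> ball u (3 * (1 - norm u)))
           \<le> ennreal (C * (1 - norm u)\<^sup>2 * \<omega> u)"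
    using assms weighted_area_tent_le[of r\<^sub>h \<omega>] by (metis greaterThanLessThan_iff)
  obtain A where A: "0 < A"
    and mean: "\<And>f w R. \<lbrakk>0 < R; f holomorphic_on ball w R\<rbrakk> \<Longrightarrow>
      ennreal (R\<^sup>2 * norm (f w) powr p)
        \<le> ennreal A * (\<integral>\<^sup>+ u. ennreal (norm (f u) powr p) * indicator (ball w R) u \<partial>lebesgue)"
    using powr_norm_le_area_integral[OF assms(1)] by blast
  have pos: "0 < \<omega> z" if "norm z < 1" for z
    using assms(3) that by (auto simp: weight_def)
  interpret disk: sigma_finite_measure disk_area
    by (rule sigma_finite_disk_area)
  interpret pair: pair_sigma_finite disk_area disk_area ..
  have \<omega>_meas [measurable]: "\<omega> \<in> borel_measurable disk_area"
    using assms(3) by (simp add: weight_def measurable_disk_area_iff)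
  \<comment> \<open>\<open>disk_area\<close> carries the Lebesgue sets, so measurability of the
    coordinate into the Borel sets is recorded for the \<open>measurable\<close> method.\<close>
  have id_meas [measurable]: "(\<lambda>z. z) \<in> borel_measurable disk_area"
    by (intro holomorphic_measurable_disk_area holomorphic_intros)
  \<comment> \<open>The factor \<open>pi\<close> comes from the normalization of area, and 9 from
    \<open>(1 - |u|)^2 <= 9 * R^2\<close>.\<close>
  define B where "B = 9 * pi * A"
  have B: "0 < B"
    using A by (simp add: B_def)
  have main: "(\<integral>\<^sup>+ z. ennreal (norm (dilation r f z) powr p * \<omega> z) \<partial>disk_area)
      \<le> ennreal (B * C) * (\<integral>\<^sup>+ z. ennreal (norm (f z) powr p * \<omega> z) \<partial>disk_area)"
    if f: "f holomorphic_on unit_disk" and r: "0 < r" "r < 1" for f r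
  proof -
    have [measurable]: "f \<in> borel_measurable disk_area"
      by (rule holomorphic_measurable_disk_area[OF f])
    define G where "G u = ennreal (B * norm (f u) powr p / (1 - norm u)\<^sup>2)" for u
    \<comment> \<open>The condition on \<open>z\<close> and \<open>u\<close> describes the tent over
      \<open>u\<close> and does not involve \<open>r\<close>. Written as a conditional, the kernel
      is jointly measurable by composition.\<close>
    define k where "k u z = G u * (ennreal (\<omega> z) * (if dist u z < 3 * (1 - norm u) then 1 else 0))" for u z
    have [measurable]: "G \<in> borel_measurable disk_area"
      unfolding G_def by measurable
    have "(\<lambda>x. fst x :: complex) \<in> borel_measurable (disk_area \<Otimes>\<^sub>M disk_area)"
      "(\<lambda>x. snd x :: complex) \<in> borel_measurable (disk_area \<Otimes>\<^sub>M disk_area)"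
      using measurable_compose[OF measurable_fst id_meas] measurable_compose[OF measurable_snd id_meas]
      by simp_all
    note [measurable] = this
    have k: "case_prod k \<in> borel_measurable (disk_area \<Otimes>\<^sub>M disk_area)"
      unfolding k_def case_prod_beta by measurable
    have kernel: "ennreal (norm (dilation r f z) powr p * \<omega> z) \<le> (\<integral>\<^sup>+ u. k u z \<partial>disk_area)"
      if z: "norm z < 1" for z
    proof -
      define w where "w = of_real r * z"
      \<comment> \<open>Half the distance from \<open>w\<close> to the circle: the disk of radius
        \<open>R\<close> stays in the unit disk, and \<open>1 - |u| <= 3 * R\<close> on it.\<close>
      define R where "R = (1 - norm w) / 2"
      have "norm w \<le> r"
        using z r by (simp add: w_def norm_mult mult_left_le)
      then have R: "0 < R"
        using r by (simp add: R_def)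
      have near: "dist u z < 3 * (1 - norm u)" "1 - norm u \<le> 3 * R" "norm u < 1" if "u \<in> ball w R" for u
        using dilation_near[OF r z w_def, of u] that by (auto simp: R_def)
      then have sub: "ball w R \<subseteq> unit_disk"
        by auto
      define g where "g u = ennreal (norm (f u) powr p) * indicator (ball w R) u" for u
      have "ball w R \<in> sets disk_area"
        using sub by (intro borel_sets_disk_area) auto
      then have [measurable]: "g \<in> borel_measurable disk_area"
        unfolding g_def by measurable
      have "ennreal (R\<^sup>2 * norm (f w) powr p) \<le> ennreal A * (\<integral>\<^sup>+ u. g u \<partial>lebesgue)"
        unfolding g_def using R f sub by (intro mean) (auto intro: holomorphic_on_subset)
      also have "(\<integral>\<^sup>+ u. g u \<partial>lebesgue) = (\<integral>\<^sup>+ u. g u * indicator unit_disk u \<partial>lebesgue)"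
        using sub by (intro nn_integral_cong) (auto simp: g_def indicator_def)
      also have "\<dots> = ennreal pi * (\<integral>\<^sup>+ u. g u \<partial>disk_area)"
        by (rule nn_integral_disk_area) measurable
      finally have mean': "ennreal (R\<^sup>2 * norm (f w) powr p)
          \<le> ennreal A * (ennreal pi * (\<integral>\<^sup>+ u. g u \<partial>disk_area))" .
      have "ennreal (norm (dilation r f z) powr p * \<omega> z)
          = ennreal (\<omega> z / R\<^sup>2) * ennreal (R\<^sup>2 * norm (f w) powr p)"
        using R pos[OF z] by (simp add: dilation_def w_def flip: ennreal_mult)
      also have "\<dots> \<le> ennreal (\<omega> z / R\<^sup>2) * (ennreal A * (ennreal pi * (\<integral>\<^sup>+ u. g u \<partial>disk_area)))"
        by (intro mult_left_mono mean') simp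
      also have "\<dots> = ennreal (\<omega> z / R\<^sup>2 * A * pi) * (\<integral>\<^sup>+ u. g u \<partial>disk_area)"
        using A pos[OF z] by (simp add: ennreal_mult mult.assoc del: times_divide_eq_left)
      also have "\<dots> = (\<integral>\<^sup>+ u. ennreal (\<omega> z / R\<^sup>2 * A * pi) * g u \<partial>disk_area)"
        by (intro nn_integral_cmult[symmetric]) measurable
      also have "\<dots> \<le> (\<integral>\<^sup>+ u. k u z \<partial>disk_area)"
      proof (rule nn_integral_mono)
        fix u
        show "ennreal (\<omega> z / R\<^sup>2 * A * pi) * g u \<le> k u z"
        proof (cases "u \<in> ball w R")
          case True
          have "(1 - norm u)\<^sup>2 \<le> 9 * R\<^sup>2"
            using power_mono[OF near(2)[OF True], of 2] near(3)[OF True] by (simp add: power_mult_distrib)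
          then have "1 / R\<^sup>2 \<le> 9 / (1 - norm u)\<^sup>2"
            using R near(3)[OF True] by (simp add: field_simps)
          then have "\<omega> z * A * pi * norm (f u) powr p * (1 / R\<^sup>2)
              \<le> \<omega> z * A * pi * norm (f u) powr p * (9 / (1 - norm u)\<^sup>2)"
            using A pos[OF z] by (intro mult_left_mono) auto
          then have "\<omega> z / R\<^sup>2 * A * pi * norm (f u) powr p
              \<le> B * norm (f u) powr p / (1 - norm u)\<^sup>2 * \<omega> z"
            by (simp add: B_def mult_ac)
          then show ?thesis
            using True near(1)[OF True] A B R pos[OF z]
            by (simp add: g_def k_def G_def ennreal_leI flip: ennreal_mult)
        qed (simp add: g_def)
      qed
      finally show ?thesis .
    qed
    have "(\<integral>\<^sup>+ z. ennreal (norm (dilation r f z) powr p * \<omega> z) \<partial>disk_area)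
        \<le> (\<integral>\<^sup>+ z. (\<integral>\<^sup>+ u. k u z \<partial>disk_area) \<partial>disk_area)"
      using kernel by (intro nn_integral_mono) simp
    \<comment> \<open>The integrand is nonnegative, so Tonelli's theorem applies whether or not the
      integrals are finite.\<close>
    also have "\<dots> = (\<integral>\<^sup>+ u. (\<integral>\<^sup>+ z. k u z \<partial>disk_area) \<partial>disk_area)"
      by (rule pair.Fubini'[OF k])
    also have "\<dots> \<le> (\<integral>\<^sup>+ u. ennreal (B * C) * ennreal (norm (f u) powr p * \<omega> u) \<partial>disk_area)"
    proof (rule nn_integral_mono)
      fix u
      assume "u \<in> space disk_area"
      then have u: "norm u < 1"
        by simp
      \<comment> \<open>For fixed \<open>u\<close>, integrating the kernel over \<open>z\<close>
        gives \<open>G u\<close> times the mass of this tent.\<close>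
      define X where "X = unit_disk \<inter> ball u (3 * (1 - norm u))"
      have X [measurable]: "X \<in> sets disk_area"
        unfolding X_def by (intro borel_sets_disk_area) auto
      have "(\<integral>\<^sup>+ z. k u z \<partial>disk_area) = (\<integral>\<^sup>+ z. G u * (ennreal (\<omega> z) * indicator X z) \<partial>disk_area)"
        by (intro nn_integral_cong) (auto simp: k_def X_def indicator_def)
      also have "\<dots> = G u * (\<integral>\<^sup>+ z. ennreal (\<omega> z) * indicator X z \<partial>disk_area)"
        by (intro nn_integral_cmult) measurable
      also have "(\<integral>\<^sup>+ z. ennreal (\<omega> z) * indicator X z \<partial>disk_area) = emeasure \<mu> X"
        unfolding assms(4) weighted_area_def using X by (intro emeasure_density[symmetric]) auto
      \<comment> \<open>The factor \<open>(1 - |u|)^2\<close> from the tent cancels the denominator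
        of \<open>G u\<close>.\<close>
      also have "G u * \<dots> \<le> G u * ennreal (C * (1 - norm u)\<^sup>2 * \<omega> u)"
        unfolding X_def by (intro mult_left_mono tent u) simp
      also have "\<dots> = ennreal (B * C) * ennreal (norm (f u) powr p * \<omega> u)"
        using u B C pos[OF u] by (simp add: G_def mult_ac flip: ennreal_mult)
      finally show "(\<integral>\<^sup>+ z. k u z \<partial>disk_area) \<le> ennreal (B * C) * ennreal (norm (f u) powr p * \<omega> u)" .
    qed
    also have "\<dots> = ennreal (B * C) * (\<integral>\<^sup>+ u. ennreal (norm (f u) powr p * \<omega> u) \<partial>disk_area)"
      by (intro nn_integral_cmult) measurable
    finally show ?thesis .
  qed
  show ?thesis
    unfolding uniformly_bounded_dilations_def
  proof (intro exI conjI ballI)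
    show "0 < (B * C) powr (1 / p)"
      using B C by simp
    fix f and r :: real
    assume "f \<in> bergman_space p \<omega>" "r \<in> {0<..<1}"
    then show "bergman_norm p \<omega> (dilation r f) \<le> ennreal ((B * C) powr (1 / p)) * bergman_norm p \<omega> f"
      unfolding bergman_norm_def using B C assms(1)
      by (intro ennreal_powr_le_mult main) (auto simp: bergman_space_def)
  qed
qed

end
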